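(* Let $A$ be a real $m\times n$ matrix with no zero rows. If $\mathrm{Rank}(A)=n$ and $A$ is reflection consistent, then $\mathrm{Rank}(I_n-R_A)=n$.
   Context: $A_i^{T}$ denotes the $i$-th row of $A$ (so $A_i$ is a column vector) and $\|\cdot\|$ is the Euclidean norm. Let $R_i=I_n-2\frac{A_iA_i^{T}}{\|A_i\|^2}$ and $R_A=R_m\cdots R_2R_1$. Reflection consistency: let $r$ be the rank of $A$ and let $a_1^{T},\ldots,a_r^{T}$ be $r$ linearly independent rows of $A$; $A$ is called reflection consistent if $R_A$ and $\prod_{i=1}^r\big(I_n-2\frac{a_ia_i^{T}}{\|a_i\|^2}\big)$ have the same eigenspace corresponding to the eigenvalue $1$ (this does not depend on the choice of $a_1,\ldots,a_r$). *)

theory Defs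
  imports "HOL-Analysis.Analysis"
begin

definition reflection_matrix :: "real^'n \<Rightarrow> real^'n^'n" where
  "reflection_matrix a =
     mat 1 - (2 / (norm a)\<^sup>2) *\<^sub>R ((columnvector a :: real^1^'n) ** (rowvector a :: real^'n^1))"

text \<open>Products of lists of square matrices, the head being the leftmost factor. The type class
  operation \<open>prod_list\<close> is unsuitable, since \<open>*\<close> on vectors and matrices is componentwise.\<close>

definition matrix_prod_list :: "(real^'n^'n) list \<Rightarrow> real^'n^'n" where
  "matrix_prod_list Ms = foldr (**) Ms (mat 1)"

text \<open>The row index type is linearly ordered, because the product depends on the order of the rows:
  the reflection in the first row is the rightmost factor, i.e. it is applied first.\<close>

definition row_reflections :: "real^'n^('m::{finite,linorder}) \<Rightarrow> real^'n^'n" where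
  "row_reflections A =
     matrix_prod_list (rev (map (\<lambda>i. reflection_matrix (row i A)) (sorted_list_of_set UNIV)))"

text \<open>This is the zero subspace if \<open>c\<close> is not an eigenvalue.\<close>

definition eigenspace :: "real^'n^'n \<Rightarrow> real \<Rightarrow> (real^'n) set" where
  "eigenspace M c = {x. M *v x = c *\<^sub>R x}"

text \<open>The eigenspace of the second product is the same for every choice (and order) of \<open>rank A\<close> linearly
  independent rows, and such a choice always exists, so quantifying over the list \<open>as\<close> universally
  would give the same notion. As \<open>as\<close> is distinct, independence of the set of its elements is
  independence of the family.\<close>

definition reflection_consistent :: "real^'n^('m::{finite,linorder}) \<Rightarrow> bool" where
  "reflection_consistent A \<longleftrightarrow>
     (\<exists>as. length as = rank A \<and> set as \<subseteq> rows A \<and> distinct as \<and> independent (set as) \<and>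
           eigenspace (row_reflections A) 1 =
             eigenspace (matrix_prod_list (map reflection_matrix as)) 1)"

end

theory Submission
  imports Defs
begin

text \<open>A product of reflections moves a vector only within the span of the reflecting vectors.
  If these are independent and the product fixes \<open>x\<close>, the contribution of each reflection must
  therefore vanish separately, so \<open>x\<close> is orthogonal to all of them. A reflection consistent
  matrix of full column rank has reflections along a basis, so only \<open>0\<close> is fixed.\<close>

text \<open>The rank-one matrix built from \<open>a\<close> sends \<open>x\<close> to
  \<open>(a \<bullet> x) *\<^sub>R a\<close>. As division by zero yields 0, both sides are
  \<open>x\<close> when \<open>a = 0\<close>.\<close>

lemma reflection_matrix_mult_vector:
  fixes a x :: "real^'n"
  shows "reflection_matrix a *v x = x - (2 * (a \<bullet> x) / (norm a)\<^sup>2) *\<^sub>R a"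
proof -
  have "((columnvector a :: real^1^'n) ** (rowvector a :: real^'n^1)) *v x = (a \<bullet> x) *\<^sub>R a"
    by (simp add: vec_eq_iff matrix_vector_mult_def matrix_matrix_mult_def columnvector_def
        rowvector_def inner_vec_def sum_distrib_left mult.commute mult.left_commute)
  then show ?thesis
    by (simp add: reflection_matrix_def matrix_vector_mult_diff_rdistrib
        scaleR_matrix_vector_assoc [symmetric])
qed

lemma matrix_prod_list_simps [simp]:
  "matrix_prod_list [] = mat 1"
  "matrix_prod_list (M # Ms) = M ** matrix_prod_list Ms"
  by (simp_all add: matrix_prod_list_def)

text \<open>Each factor changes its argument by a multiple of its own vector, and these changes add
  up.\<close>

lemma reflections_diff_in_span:
  "matrix_prod_list (map reflection_matrix as) *v x - x \<in> span (set as)"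
proof (induction as)
  case Nil
  then show ?case by simp
next
  case (Cons a as)
  let ?y = "matrix_prod_list (map reflection_matrix as) *v x"
  have "?y - x \<in> span (set (a # as))"
    using Cons span_mono [of "set as" "set (a # as)"] by auto
  moreover have "(2 * (a \<bullet> ?y) / (norm a)\<^sup>2) *\<^sub>R a \<in> span (set (a # as))"
    by (intro span_scale span_base) simp
  ultimately have "(?y - x) - (2 * (a \<bullet> ?y) / (norm a)\<^sup>2) *\<^sub>R a \<in> span (set (a # as))"
    by (rule span_diff)
  then show ?case
    by (simp add: matrix_vector_mul_assoc [symmetric] reflection_matrix_mult_vector algebra_simps)
qed

lemma fixed_by_independent_reflections_imp_orthogonal:
  assumes "independent (set as)" "distinct as"
    and "matrix_prod_list (map reflection_matrix as) *v x = x"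
    and "b \<in> set as"
  shows "b \<bullet> x = 0"
  using assms
proof (induction as)
  case Nil
  then show ?case by simp
next
  case (Cons a as)
  let ?y = "matrix_prod_list (map reflection_matrix as) *v x"
  let ?c = "2 * (a \<bullet> ?y) / (norm a)\<^sup>2"
  have a: "a \<notin> span (set as)" and ind: "independent (set as)"
    using Cons.prems(1,2) by (auto simp: independent_insert)
  then have "a \<noteq> 0"
    using span_zero by metis
  \<comment> \<open>The leftmost reflection carries \<open>?y\<close> back to \<open>x\<close>, so
    it exactly undoes the displacement made by the other factors.\<close>
  have eq: "?y - x = ?c *\<^sub>R a"
    using Cons.prems(3)
    by (simp add: matrix_vector_mul_assoc [symmetric] reflection_matrix_mult_vector algebra_simps)
  then have "?c *\<^sub>R a \<in> span (set as)"
    using reflections_diff_in_span by metis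
  \<comment> \<open>Otherwise, dividing by \<open>?c\<close> would put \<open>a\<close> into
    \<open>span (set as)\<close>.\<close>
  then have c: "?c = 0"
    using a by (metis span_scale scaleR_one scaleR_scaleR left_inverse)
  \<comment> \<open>The shorter product thus fixes \<open>x\<close> as well, so the induction
    hypothesis handles the vectors in \<open>as\<close>; for \<open>a\<close> itself,
    \<open>?c = 0\<close> gives orthogonality.\<close>
  then have y: "?y = x"
    using eq unfolding c by simp
  moreover have "a \<bullet> ?y = 0"
    using c \<open>a \<noteq> 0\<close> by simp
  ultimately show ?case
    using Cons ind by auto
qed

theorem proposition25:
  fixes A :: "real^'n^('m::{finite,linorder})"
  assumes "\<forall>i. row i A \<noteq> 0"
    and "rank A = CARD('n)"
    and "reflection_consistent A"
  shows "rank (mat 1 - row_reflections A) = CARD('n)"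
proof -
  obtain as where as: "length as = CARD('n)" "distinct as" "independent (set as)"
    and eigen: "eigenspace (row_reflections A) 1 =
      eigenspace (matrix_prod_list (map reflection_matrix as)) 1"
    using assms(2,3) by (auto simp: reflection_consistent_def)
  have "card (set as) = CARD('n)"
    using as distinct_card by metis
  then have span: "span (set as) = UNIV"
    using as(3) card_ge_dim_independent [of "set as" UNIV] by auto
  have "x = 0" if "(mat 1 - row_reflections A) *v x = 0" for x
  proof -
    have "x \<in> eigenspace (row_reflections A) 1"
      using that by (simp add: eigenspace_def matrix_vector_mult_diff_rdistrib)
    then have "matrix_prod_list (map reflection_matrix as) *v x = x"
      unfolding eigen by (simp add: eigenspace_def)
    then have "b \<in> set as \<Longrightarrow> orthogonal x b" for b
      using fixed_by_independent_reflections_imp_orthogonal as(2,3)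
      by (metis orthogonal_def inner_commute)
    \<comment> \<open>Orthogonality to a spanning set extends to the whole space, in particular to
      \<open>x\<close>.\<close>
    then have "orthogonal x x"
      using span orthogonal_to_span [of x "set as" x] by auto
    then show ?thesis
      by (simp add: orthogonal_self)
  qed
  then have "inj ((*v) (mat 1 - row_reflections A))"
    by (simp add: linear_injective_0)
  then show ?thesis
    by (simp add: full_rank_injective)
qed

end
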